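(* Let $H\le \mathrm{PL}_0(\mathbf{I})$ be a subgroup isomorphic to Thompson's group $F$. Then there exist an orbital $W=(a,c)$ of $H$ and an element $h\in H$ such that either $h|_W$ moves points near $a$ but not near $c$, or $h|_W$ moves points near $c$ but not near $a$.
   Context: $\mathrm{PL}_0(\mathbf{I})$ is the group of orientation-preserving piecewise-linear homeomorphisms of $[0,1]$ with finitely many points of non-differentiability. For a subgroup $H$, $\operatorname{Supp}(H)=\{x\in[0,1]: xh\ne x \text{ for some } h\in H\}$; it is a disjoint union of open intervals, called the orbitals of $H$. Thompson's group $F=\langle x_0,x_1\mid [x_0x_1^{-1},x_1^{x_0}]=[x_0x_1^{-1},x_1^{x_0^2}]=1\rangle$. "$h|_W$ moves points near $a$ but not near $c$" means: for every $\varepsilon>0$, $h$ is not the identity on $(a,a+\varepsilon)$, while for some $\delta>0$, $h$ is the identity on $(c-\delta,c)$; symmetrically for the other case. *)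

theory Defs
  imports Complex_Main "HOL-Algebra.Group"
begin

text \<open>Elements of PL_0(I) are represented as functions real => real that are the
identity outside [0,1] (so that composition is the group law).  A map is in PL_0(I)
iff on [0,1] it is a strictly increasing continuous surjection onto [0,1] (an
orientation-preserving homeomorphism) which is affine on each piece of a finite
subdivision 0 = t_0 < t_1 < ... < t_n = 1.\<close>

definition PL0 :: "(real \<Rightarrow> real) set" where
  "PL0 = {f. (\<forall>x. x \<notin> {0..1} \<longrightarrow> f x = x)
           \<and> strict_mono_on {0..1} f
           \<and> continuous_on {0..1} f
           \<and> f ` {0..1} = {0..1}
           \<and> (\<exists>ts :: real list. sorted_wrt (<) ts \<and> ts \<noteq> [] \<and> hd ts = 0 \<and> last ts = 1 \<and>
                (\<forall>i. Suc i < length ts \<longrightarrow>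
                   (\<exists>m k. \<forall>x \<in> {ts ! i .. ts ! Suc i}. f x = m * x + k)))}"

text \<open>Right action, as in the paper: x(gh) = (xg)h, so the product g h is h o g.\<close>
definition PL0_group :: "(real \<Rightarrow> real) monoid" where
  "PL0_group = \<lparr>carrier = PL0, mult = (\<lambda>g h. h \<circ> g), one = id\<rparr>"

text \<open>Words in x0, x1 and inverses: a letter is (generator, inverted?),
generator False = x0, True = x1.\<close>
type_synonym fword = "(bool \<times> bool) list"

definition "fx0 = (False, False)"
definition "fX0 = (False, True)"
definition "fx1 = (True, False)"
definition "fX1 = (True, True)"

definition letter_inv :: "bool \<times> bool \<Rightarrow> bool \<times> bool" where
  "letter_inv l = (fst l, \<not> snd l)"

definition word_inv :: "fword \<Rightarrow> fword" where
  "word_inv w = rev (map letter_inv w)"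

definition word_comm :: "fword \<Rightarrow> fword \<Rightarrow> fword" where
  "word_comm u v = word_inv u @ word_inv v @ u @ v"

definition word_conj :: "fword \<Rightarrow> fword \<Rightarrow> fword" where
  "word_conj v u = word_inv u @ v @ u"

definition F_relators :: "fword set" where
  "F_relators = { word_comm [fx0, fX1] (word_conj [fx1] [fx0]),
                  word_comm [fx0, fX1] (word_conj [fx1] [fx0, fx0]) }"

inductive_set F_equiv :: "(fword \<times> fword) set" where
  refl: "(w, w) \<in> F_equiv"
| sym: "(u, v) \<in> F_equiv \<Longrightarrow> (v, u) \<in> F_equiv"
| trans: "(u, v) \<in> F_equiv \<Longrightarrow> (v, w) \<in> F_equiv \<Longrightarrow> (u, w) \<in> F_equiv"
| ctxt: "(u, v) \<in> F_equiv \<Longrightarrow> (p @ u @ q, p @ v @ q) \<in> F_equiv"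
| cancel: "([l, letter_inv l], []) \<in> F_equiv"
| relator: "r \<in> F_relators \<Longrightarrow> (r, []) \<in> F_equiv"

definition thompson_F :: "fword set monoid" where
  "thompson_F = \<lparr>carrier = UNIV // F_equiv,
                 mult = (\<lambda>A B. \<Union>a\<in>A. \<Union>b\<in>B. F_equiv `` {a @ b}),
                 one = F_equiv `` {[]}\<rparr>"

definition Supp :: "(real \<Rightarrow> real) set \<Rightarrow> real set" where
  "Supp H = {x \<in> {0..1}. \<exists>h \<in> H. h x \<noteq> x}"

text \<open>(a,c) is an orbital of H: a maximal open interval contained in Supp H
(Supp H is open, so these are exactly its connected components).\<close>
definition orbital :: "(real \<Rightarrow> real) set \<Rightarrow> real \<Rightarrow> real \<Rightarrow> bool" where
  "orbital H a c \<longleftrightarrow> a < c \<and> {a<..<c} \<subseteq> Supp H \<and> a \<notin> Supp H \<and> c \<notin> Supp H"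

definition moves_near_left :: "(real \<Rightarrow> real) \<Rightarrow> real \<Rightarrow> bool" where
  "moves_near_left h a \<longleftrightarrow> (\<forall>\<epsilon>>0. \<exists>x\<in>{a<..<a+\<epsilon>}. h x \<noteq> x)"

definition moves_near_right :: "(real \<Rightarrow> real) \<Rightarrow> real \<Rightarrow> bool" where
  "moves_near_right h c \<longleftrightarrow> (\<forall>\<epsilon>>0. \<exists>x\<in>{c-\<epsilon><..<c}. h x \<noteq> x)"

definition fixes_near_left :: "(real \<Rightarrow> real) \<Rightarrow> real \<Rightarrow> bool" where
  "fixes_near_left h a \<longleftrightarrow> (\<exists>\<delta>>0. \<forall>x\<in>{a<..<a+\<delta>}. h x = x)"

definition fixes_near_right :: "(real \<Rightarrow> real) \<Rightarrow> real \<Rightarrow> bool" where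
  "fixes_near_right h c \<longleftrightarrow> (\<exists>\<delta>>0. \<forall>x\<in>{c-\<delta><..<c}. h x = x)"

end

theory Submission
  imports Defs
begin

text \<open>Write \<open>x\<^sub>n\<close> for the standard infinite generating sequence of \<open>F\<close> and put \<open>y = x\<^sub>0 x\<^sub>1\<inverse>\<close>,
which commutes with every \<open>x\<^sub>n\<close>, \<open>n \<ge> 2\<close>.  Since \<open>F\<close> is not abelian, \<open>H\<close> has an orbital \<open>(l, r)\<close> on which
\<open>x\<^sub>2\<close> and \<open>x\<^sub>3\<close> do not commute.  Suppose every element of \<open>H\<close> is trivial near \<open>l\<close> iff it is trivial
near \<open>r\<close>.

If \<open>y\<close> is nontrivial near both ends, let \<open>D\<^sub>n\<close> be the set of points of \<open>(l, r)\<close> at which \<open>x\<^sub>n\<close> and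
\<open>x\<^sub>n\<^sub>+\<^sub>1\<close> do not commute.  Affine germs commute, and the commutator centralises \<open>y\<close>, so it is trivial
on the basins of \<open>y\<close> at \<open>l\<close> and \<open>r\<close>; hence all \<open>D\<^sub>n\<close> lie in one compact subinterval.  Moreover
\<open>x\<^sub>0\<close> maps \<open>D\<^sub>n\<close> to \<open>D\<^sub>n\<^sub>+\<^sub>1\<close> and \<open>y\<close> preserves it.  So the points \<open>inf D\<^sub>n\<close> form a monotone bounded
sequence whose limit is fixed by \<open>x\<^sub>0\<close> and \<open>y\<close>, hence by \<open>H\<close>, although it lies inside an orbital.

If \<open>y\<close> is trivial near both ends, the same argument applies to the supports in \<open>(l, r)\<close> of the
conjugates \<open>x\<^sub>0\<^sup>n y x\<^sub>0\<^sup>-\<^sup>n\<close>, \<open>n \<ge> 1\<close>: they are preserved by \<open>x\<^sub>1\<close> and shifted both by \<open>x\<^sub>0\<inverse>\<close> and by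
\<open>y\<inverse>\<close>, and the latter keeps them in a compact subinterval.\<close>

unbundle no m_inv_syntax

section \<open>Words acting by bijections\<close>

lemma letter_inv_invol [simp]: "letter_inv (letter_inv l) = l"
  by (simp add: letter_inv_def)

lemma word_inv_invol [simp]: "word_inv (word_inv w) = w"
  by (simp add: word_inv_def rev_map comp_def)

text \<open>Words are read from left to right, so concatenation becomes composition in reverse
  order. The locale serves both the action on the line that detects noncommutativity and the
  realisation of words by elements of \<open>H\<close>.\<close>

locale word_action =
  fixes e :: "fword \<Rightarrow> 'a \<Rightarrow> 'a"
  assumes e_Nil: "e [] = id"
    and e_append: "e (u @ v) = e v \<circ> e u"
    and e_letter_inv: "e [l, letter_inv l] = id"
begin

lemma e_Cons: "e (l # w) = e w \<circ> e [l]"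
  using e_append[of "[l]" w] by simp

lemma e_word_inv_left: "e (word_inv w) (e w t) = t"
proof (induction w arbitrary: t)
  case Nil
  then show ?case by (simp add: word_inv_def e_Nil)
next
  case (Cons l w)
  have "e [letter_inv l] (e [l] t) = t"
    using e_letter_inv[of l] e_append[of "[l]" "[letter_inv l]"] by (auto simp: fun_eq_iff)
  moreover have "e (word_inv (l # w)) = e [letter_inv l] \<circ> e (word_inv w)"
    by (simp add: word_inv_def e_append)
  ultimately show ?case using Cons by (simp add: e_Cons[of l w])
qed

lemma e_word_inv_right: "e w (e (word_inv w) t) = t"
  using e_word_inv_left[of "word_inv w"] by simp

lemma bij_e: "bij (e w)"
  by (rule o_bij[of "e (word_inv w)"]) (auto simp: fun_eq_iff e_word_inv_left e_word_inv_right)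

lemma e_word_inv: "e (word_inv w) = inv (e w)"
  by (rule inv_unique_comp[symmetric]) (auto simp: fun_eq_iff e_word_inv_left e_word_inv_right)

lemma e_word_conj: "e (word_conj v u) = e u \<circ> e v \<circ> inv (e u)"
  by (simp add: word_conj_def e_append e_word_inv)

lemma e_word_comm_eq_id_iff: "e (word_comm u v) = id \<longleftrightarrow> e u \<circ> e v = e v \<circ> e u"
proof -
  have comm: "e (word_comm u v) (e u (e v t)) = e v (e u t)" for t
    by (simp add: word_comm_def e_append e_word_inv_left)
  show ?thesis
  proof
    assume "e (word_comm u v) = id"
    then show "e u \<circ> e v = e v \<circ> e u" using comm by (auto simp: fun_eq_iff)
  next
    assume "e u \<circ> e v = e v \<circ> e u"
    then have "e (word_comm u v) (e u (e v t)) = e u (e v t)" for t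
      using comm by (simp add: fun_eq_iff)
    \<comment> \<open>Every point has the form \<open>e u (e v t)\<close>, as \<open>e u\<close> and
      \<open>e v\<close> are onto.\<close>
    from this[of "e (word_inv v) (e (word_inv u) _)"] show "e (word_comm u v) = id"
      by (simp add: fun_eq_iff e_word_inv_right)
  qed
qed

lemma F_relators_eq_id:
  assumes "e [fx0, fX1] \<circ> e (word_conj [fx1] [fx0]) = e (word_conj [fx1] [fx0]) \<circ> e [fx0, fX1]"
    and "e [fx0, fX1] \<circ> e (word_conj [fx1] [fx0, fx0])
       = e (word_conj [fx1] [fx0, fx0]) \<circ> e [fx0, fX1]"
    and "r \<in> F_relators"
  shows "e r = id"
  using assms by (auto simp: F_relators_def e_word_comm_eq_id_iff)

lemma F_equiv_imp_eq:
  assumes "\<And>r. r \<in> F_relators \<Longrightarrow> e r = id" and "(u, v) \<in> F_equiv"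
  shows "e u = e v"
  using assms(2)
  by (induction rule: F_equiv.induct) (simp_all add: e_append e_Nil e_letter_inv assms(1))

end

lemma equiv_F_equiv: "equiv UNIV F_equiv"
  by (rule equivI) (auto simp: refl_on_def sym_def trans_def
      intro: F_equiv.refl F_equiv.sym F_equiv.trans)

lemma F_equiv_append:
  assumes "(u, u') \<in> F_equiv" "(v, v') \<in> F_equiv"
  shows "(u @ v, u' @ v') \<in> F_equiv"
  using F_equiv.ctxt[OF assms(1), of "[]" v] F_equiv.ctxt[OF assms(2), of u' "[]"]
  by (auto intro: F_equiv.trans)

lemma thompson_F_mult:
  "F_equiv `` {u} \<otimes>\<^bsub>thompson_F\<^esub> F_equiv `` {v} = F_equiv `` {u @ v}"
proof -
  have eq: "F_equiv `` {x @ z} = F_equiv `` {u @ v}"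
    if "x \<in> F_equiv `` {u}" "z \<in> F_equiv `` {v}" for x z
    using that F_equiv_append[of u x v z] equiv_class_eq[OF equiv_F_equiv] by blast
  have "F_equiv `` {u} \<otimes>\<^bsub>thompson_F\<^esub> F_equiv `` {v}
      = (\<Union>x\<in>F_equiv `` {u}. \<Union>z\<in>F_equiv `` {v}. F_equiv `` {x @ z})"
    by (simp add: thompson_F_def)
  also have "\<dots> = (\<Union>x\<in>F_equiv `` {u}. \<Union>z\<in>F_equiv `` {v}. F_equiv `` {u @ v})"
    by (intro SUP_cong) (simp_all only: eq)
  also have "\<dots> = F_equiv `` {u @ v}"
    using F_equiv.refl[of u] F_equiv.refl[of v] by blast
  finally show ?thesis .
qed

section \<open>Noncommutativity of \<open>F\<close> from an explicit action\<close>

text \<open>Noncommutativity of the presented group is read off from its action on the real line with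
\<open>x\<^sub>0\<close> the unit translation and \<open>x\<^sub>1\<close> the map \<open>slide\<close>.\<close>
definition slide :: "real \<Rightarrow> real" where
  "slide t = (if t \<le> 0 then t else if t \<le> 1 then 2 * t else t + 1)"

definition slide_inv :: "real \<Rightarrow> real" where
  "slide_inv t = (if t \<le> 0 then t else if t \<le> 2 then t / 2 else t - 1)"

lemma slide_inverses [simp]: "slide (slide_inv t) = t" "slide_inv (slide t) = t"
  by (auto simp: slide_def slide_inv_def)

fun line_letter :: "bool \<times> bool \<Rightarrow> real \<Rightarrow> real" where
  "line_letter (False, False) t = t + 1"
| "line_letter (False, True) t = t - 1"
| "line_letter (True, False) t = slide t"
| "line_letter (True, True) t = slide_inv t"

fun line_word :: "fword \<Rightarrow> real \<Rightarrow> real" where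
  "line_word [] t = t"
| "line_word (l # w) t = line_word w (line_letter l t)"

lemma line_word_append: "line_word (u @ v) t = line_word v (line_word u t)"
  by (induction u arbitrary: t) auto

lemma line_letter_inv: "line_letter (letter_inv l) (line_letter l t) = t"
  by (cases l rule: prod.exhaust; cases "fst l"; cases "snd l") (auto simp: letter_inv_def)

interpretation line: word_action line_word
  by unfold_locales (auto simp: fun_eq_iff line_word_append line_letter_inv)

lemmas word_defs = fx0_def fX0_def fx1_def fX1_def word_conj_def word_inv_def letter_inv_def

text \<open>The relators act trivially because supports are disjoint: \<open>[fx0, fX1]\<close>
  fixes every \<open>t \<ge> 1\<close>, while both conjugates of \<open>fx1\<close> fix every
  \<open>t \<le> 1\<close>.\<close>

lemma line_word_F_equiv: "(u, v) \<in> F_equiv \<Longrightarrow> line_word u = line_word v"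
proof (rule line.F_equiv_imp_eq[OF line.F_relators_eq_id])
  show "line_word [fx0, fX1] \<circ> line_word (word_conj [fx1] [fx0])
      = line_word (word_conj [fx1] [fx0]) \<circ> line_word [fx0, fX1]"
    by (auto simp: word_defs fun_eq_iff slide_def slide_inv_def)
  show "line_word [fx0, fX1] \<circ> line_word (word_conj [fx1] [fx0, fx0])
      = line_word (word_conj [fx1] [fx0, fx0]) \<circ> line_word [fx0, fX1]"
    by (auto simp: word_defs fun_eq_iff slide_def slide_inv_def)
qed

lemma F_not_abelian:
  "([fx1] @ word_conj [fx1] [fx0], word_conj [fx1] [fx0] @ [fx1]) \<notin> F_equiv"
proof
  assume "([fx1] @ word_conj [fx1] [fx0], word_conj [fx1] [fx0] @ [fx1]) \<in> F_equiv"
  \<comment> \<open>The point 1 goes to 3 under the first word and to 2 under the second.\<close>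
  from fun_cong[OF line_word_F_equiv[OF this], of 1] show False
    by (simp add: word_defs slide_def)
qed

section \<open>The infinite family of relations of \<open>F\<close>\<close>

text \<open>Composition reverses words: \<open>inv b \<circ> a\<close> is \<open>x0 x1^-1\<close>,
  and \<open>a \<circ> b \<circ> inv a\<close> is \<open>x1\<close> conjugated by \<open>x0\<close>.
  So the hypotheses are the two defining relators, for bijections of any set.\<close>

locale thompson_pair =
  fixes a b :: "'a \<Rightarrow> 'a"
  assumes bij_a: "bij a" and bij_b: "bij b"
    and rel1: "(inv b \<circ> a) \<circ> (a \<circ> b \<circ> inv a) = (a \<circ> b \<circ> inv a) \<circ> (inv b \<circ> a)"
    and rel2: "(inv b \<circ> a) \<circ> (a \<circ> a \<circ> b \<circ> inv (a \<circ> a)) = (a \<circ> a \<circ> b \<circ> inv (a \<circ> a)) \<circ> (inv b \<circ> a)"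
begin

text \<open>For \<open>a = x\<^sub>0\<close> and \<open>b = x\<^sub>1\<close>, the map \<open>g n\<close> is \<open>x\<^sub>n\<^sub>+\<^sub>1\<close>; products of the paper are read from left
to right.\<close>
definition y :: "'a \<Rightarrow> 'a" where "y = inv b \<circ> a"

definition g :: "nat \<Rightarrow> 'a \<Rightarrow> 'a" where "g n = (a ^^ n) \<circ> b \<circ> (inv a ^^ n)"

definition h :: "nat \<Rightarrow> 'a \<Rightarrow> 'a" where "h n = (inv a ^^ n) \<circ> y \<circ> (a ^^ n)"

lemma inverses [simp]: "a (inv a t) = t" "inv a (a t) = t" "b (inv b t) = t" "inv b (b t) = t"
  using bij_a bij_b by (simp_all add: bij_is_surj surj_f_inv_f bij_is_inj)

lemma pow_inverses [simp]: "(a ^^ n) ((inv a ^^ n) t) = t" "(inv a ^^ n) ((a ^^ n) t) = t"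
  by (induction n arbitrary: t) (simp_all add: funpow_swap1)

lemma bij_y: "bij y"
  unfolding y_def using bij_a bij_b by (intro bij_comp bij_imp_bij_inv)

lemma b_y: "b (y t) = a t"
  by (simp add: y_def)

lemma a_g: "a (g n t) = g (Suc n) (a t)"
  by (simp add: g_def funpow_swap1)

lemma a_b: "a (b t) = g 1 (a t)"
  by (simp add: g_def)

lemma g_1: "g 1 = a \<circ> b \<circ> inv a" by (simp add: g_def)

lemma g_2: "g 2 = a \<circ> a \<circ> b \<circ> inv (a \<circ> a)"
  using bij_a by (simp add: g_def numeral_2_eq_2 fun_eq_iff o_inv_distrib)

lemma g_Suc: "g (Suc n) t = a (g n (inv a t))"
  by (simp add: a_g)

text \<open>Follows from \<open>b \<circ> y = a\<close>, since \<open>a\<close> carries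
  \<open>g n\<close> to \<open>g (Suc n)\<close>. It translates the relators into conjugation
  relations for \<open>b\<close>, and the latter back into commutation with
  \<open>y\<close>.\<close>

lemma y_g_iff: "y (g n t) = g n (y t) \<longleftrightarrow> g (Suc n) (b (y t)) = b (g n (y t))"
  by (metis a_g b_y inverses(4))

text \<open>The classical deduction of all relations from two. The cases \<open>n = 0\<close> and
  \<open>n = 1\<close> are the relators. Beyond them, \<open>g (Suc n)\<close> is the conjugate of
  \<open>g n\<close> by \<open>g 1\<close>; \<open>b\<close> carries this pair to
  \<open>g (Suc n)\<close> and \<open>g 2\<close>, whose conjugate is
  \<open>g (Suc (Suc n))\<close>.\<close>

lemma b_g: "b (g (Suc n) t) = g (Suc (Suc n)) (b t)"
proof (induction n arbitrary: t rule: less_induct)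
  case (less n)
  obtain w where w: "t = y w" using bij_y by (metis bij_is_surj surj_def)
  consider "n = 0" | "n = 1" | m where "n = Suc (Suc m)" by (metis One_nat_def not0_implies_Suc)
  then show ?case
  proof cases
    case 1
    have "y (g 1 w) = g 1 (y w)"
      using fun_cong[OF rel1, of w] unfolding g_1 y_def by simp
    then show ?thesis using y_g_iff[of 1 w] 1 w by simp
  next
    case 2
    have "y (g 2 w) = g 2 (y w)"
      using fun_cong[OF rel2, of w] unfolding g_2 y_def by simp
    then show ?thesis using y_g_iff[of 2 w] 2 w by (simp add: numeral_2_eq_2)
  next
    case 3
    have IH0: "b (g (Suc m) t) = g (Suc (Suc m)) (b t)" for t using less 3 by simp
    have IH1: "b (g (Suc (Suc m)) t) = g (Suc (Suc (Suc m))) (b t)" for t using less 3 by simp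
    have IHb: "b (g 1 t) = g 2 (b t)" for t using less 3 by (simp add: numeral_2_eq_2)
    \<comment> \<open>Conjugating the induction hypothesis by \<open>a\<close> once, then twice,
      replaces \<open>b\<close> by \<open>g 1\<close>, then by \<open>g 2\<close>.\<close>
    have s1: "g 1 (g (Suc (Suc m)) t) = g (Suc (Suc (Suc m))) (g 1 t)" for t
      using arg_cong[OF IH0[of "inv a t"], of a] by (simp add: a_b a_g)
    have s2: "g 2 (g (Suc (Suc (Suc m))) t) = g (Suc (Suc (Suc (Suc m)))) (g 2 t)" for t
      using arg_cong[OF s1[of "inv a t"], of a] by (simp add: a_g numeral_2_eq_2)
    obtain w where w: "t = g 1 w"
      using that[of "a (inv b (inv a t))"] unfolding g_1 by simp
    have "b (g (Suc n) t) = b (g 1 (g (Suc (Suc m)) w))" using s1 w 3 by simp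
    also have "\<dots> = g 2 (g (Suc (Suc (Suc m))) (b w))" using IHb IH1 by simp
    also have "\<dots> = g (Suc (Suc n)) (b t)" using s2 IHb w 3 by simp
    finally show ?thesis .
  qed
qed

lemma y_g: "y (g (Suc n) t) = g (Suc n) (y t)"
  using y_g_iff b_g by simp

text \<open>Conjugating \<open>y_g\<close> back by \<open>a ^^ Suc n\<close> turns
  \<open>g (Suc n)\<close> into \<open>b\<close> and \<open>y\<close> into
  \<open>h (Suc n)\<close>.\<close>

lemma b_h: "b (h (Suc n) t) = h (Suc n) (b t)"
proof -
  have b_left: "b w = (inv a ^^ Suc n) (g (Suc n) ((a ^^ Suc n) w))" for w
    unfolding g_def by (simp only: comp_apply pow_inverses)
  have b_right: "(a ^^ Suc n) (b t) = g (Suc n) ((a ^^ Suc n) t)"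
    unfolding g_def by (simp only: comp_apply pow_inverses)
  have "b (h (Suc n) t) = (inv a ^^ Suc n) (g (Suc n) ((a ^^ Suc n) (h (Suc n) t)))"
    by (rule b_left)
  also have "\<dots> = (inv a ^^ Suc n) (y (g (Suc n) ((a ^^ Suc n) t)))"
    unfolding h_def by (simp only: comp_apply pow_inverses y_g)
  also have "\<dots> = h (Suc n) (b t)"
    unfolding h_def by (simp only: comp_apply b_right)
  finally show ?thesis .
qed

lemma inv_a_h: "inv a (h n t) = h (Suc n) (inv a t)"
proof -
  have "(a ^^ Suc n) (inv a t) = (a ^^ n) t"
    by (simp only: funpow_Suc_right comp_apply inverses)
  then show ?thesis by (simp add: h_def)
qed

end

section \<open>Increasing bijections of the line and common fixed points\<close>

lemma isCont_strict_mono_surj: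
  fixes f :: "real \<Rightarrow> real"
  assumes "strict_mono f" "surj f"
  shows "isCont f x"
proof -
  have "continuous_on UNIV f"
    by (rule continuous_onI_mono) (auto simp: assms strict_mono_less_eq)
  then show ?thesis by (simp add: continuous_on_eq_continuous_at)
qed

lemma Inf_image_strict_mono_surj:
  fixes f :: "real \<Rightarrow> real"
  assumes "strict_mono f" "surj f" "S \<noteq> {}" "bdd_below S"
  shows "f (Inf S) = Inf (f ` S)"
  using continuous_at_Inf_mono[OF strict_mono_mono[OF assms(1)]
      continuous_at_imp_continuous_at_within[OF isCont_strict_mono_surj[OF assms(1,2)]] assms(3,4)] .

text \<open>The infima of the sets form a bounded orbit of the monotone map \<open>f\<close>, all of whose points
are fixed by \<open>k\<close>; its limit is the required point.\<close>
lemma common_fixed_point: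
  fixes f k :: "real \<Rightarrow> real"
  assumes f: "strict_mono f" "surj f" and k: "strict_mono k" "surj k"
    and ne: "D 0 \<noteq> {}" and sub: "\<And>n. D n \<subseteq> {l..r}"
    and step: "\<And>n. D (Suc n) = f ` D n" and inv: "\<And>n. k ` D n = D n"
  shows "\<exists>s\<in>{l..r}. f s = s \<and> k s = s"
proof -
  define p where "p n = Inf (D n)" for n
  have D_ne: "D n \<noteq> {}" for n
    using ne by (induction n) (simp_all add: step)
  have D_bdd: "bdd_below (D n)" for n
    using sub[of n] by (intro bdd_belowI[of _ l]) auto
  note D = D_ne D_bdd
  have p_Suc: "p (Suc n) = f (p n)" for n
    using Inf_image_strict_mono_surj[OF f D] by (simp add: p_def step)
  have k_p: "k (p n) = p n" for n
    using Inf_image_strict_mono_surj[OF k D] by (simp add: p_def inv)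
  have p_bounds: "l \<le> p n" "p n \<le> r" for n
  proof -
    obtain x where "x \<in> D n" using D by blast
    then show "p n \<le> r" using cInf_lower[of x "D n"] D sub[of n] by (auto simp: p_def)
    show "l \<le> p n" unfolding p_def using D sub[of n] by (intro cInf_greatest) auto
  qed
  \<comment> \<open>As \<open>f\<close> is increasing, the direction of the first step of the orbit
    persists.\<close>
  have "monoseq p"
  proof (cases "p 0 \<le> p 1")
    case True
    have "p n \<le> p (Suc n)" for n
      using True by (induction n) (auto simp: p_Suc strict_mono_less_eq[OF f(1)])
    then show ?thesis by (simp add: monoseq_Suc)
  next
    case False
    have "p (Suc n) \<le> p n" for n
      using False by (induction n) (auto simp: p_Suc strict_mono_less_eq[OF f(1)])
    then show ?thesis by (simp add: monoseq_Suc)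
  qed
  moreover have "Bseq p"
  proof (rule BseqI')
    show "norm (p n) \<le> \<bar>l\<bar> + \<bar>r\<bar>" for n using p_bounds[of n] by auto
  qed
  ultimately obtain s where s: "p \<longlonglongrightarrow> s"
    using Bseq_monoseq_convergent by (auto simp: convergent_def)
  have "(\<lambda>n. f (p n)) \<longlonglongrightarrow> f s" "(\<lambda>n. k (p n)) \<longlonglongrightarrow> k s"
    using isCont_tendsto_compose[OF isCont_strict_mono_surj[OF f] s]
      isCont_tendsto_compose[OF isCont_strict_mono_surj[OF k] s] .
  moreover have "(\<lambda>n. f (p n)) \<longlonglongrightarrow> s"
    using LIMSEQ_Suc[OF s] by (simp add: p_Suc)
  moreover have "(\<lambda>n. k (p n)) \<longlonglongrightarrow> s"
    using s by (simp only: k_p)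
  ultimately have "f s = s" "k s = s"
    by (simp_all only: LIMSEQ_unique)
  moreover have "s \<in> {l..r}"
    using LIMSEQ_le_const[OF s] LIMSEQ_le_const2[OF s] p_bounds by auto
  ultimately show ?thesis by blast
qed

section \<open>Affine germs and centralisers\<close>

lemma funpow_affine:
  fixes y :: "real \<Rightarrow> real"
  assumes "\<And>s. s \<in> {0..\<delta>} \<Longrightarrow> y (e + \<sigma> * s) = e + \<sigma> * (m * s)" and "m > 0" "s \<ge> 0"
    and "\<And>i. i \<le> n \<Longrightarrow> m ^ i * s \<le> \<delta>"
  shows "(y ^^ n) (e + \<sigma> * s) = e + \<sigma> * (m ^ n * s)"
  using assms(4)
proof (induction n)
  case (Suc n)
  then show ?case using assms(1)[of "m ^ n * s"] assms(2,3) by (simp add: mult.assoc)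
qed simp

text \<open>An iterate of \<open>y\<close>, or of its inverse if \<open>m > 1\<close>, brings the point into the region where
\<open>u\<close> and \<open>v\<close> agree.\<close>
lemma commuting_eq_of_germ_eq:
  fixes y u v :: "real \<Rightarrow> real"
  assumes y: "inj y" and aff: "\<And>s. s \<in> {0..\<delta>} \<Longrightarrow> y (e + \<sigma> * s) = e + \<sigma> * (m * s)"
    and m: "m > 0" "m \<noteq> 1"
    and u: "\<And>t. u (y t) = y (u t)" and v: "\<And>t. v (y t) = y (v t)"
    and germ: "\<eta> > 0" "\<And>s. s \<in> {0<..<\<eta>} \<Longrightarrow> u (e + \<sigma> * s) = v (e + \<sigma> * s)"
    and s: "s \<in> {0<..\<delta>}"
  shows "u (e + \<sigma> * s) = v (e + \<sigma> * s)"
proof -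
  have pow: "u ((y ^^ n) t) = (y ^^ n) (u t)" "v ((y ^^ n) t) = (y ^^ n) (v t)" for n t
    by (induction n) (simp_all add: u v)
  show ?thesis
  proof (cases "m < 1")
    case True
    \<comment> \<open>Contraction: iterating \<open>y\<close> brings the point into the region of
      agreement, and injectivity of \<open>y ^^ n\<close> pulls the equality back.\<close>
    obtain n where "m ^ n < \<eta> / s"
      using real_arch_pow_inv[of "\<eta> / s" m] True s germ(1) by auto
    then have n: "m ^ n * s < \<eta>" using s by (simp add: pos_less_divide_eq)
    have le: "m ^ i * s \<le> \<delta>" for i
    proof -
      have "m ^ i * s \<le> s"
        using True m s by (intro mult_left_le_one_le power_le_one) auto
      also have "s \<le> \<delta>" using s by simp
      finally show ?thesis .
    qed
    have "(y ^^ n) (e + \<sigma> * s) = e + \<sigma> * (m ^ n * s)"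
      by (rule funpow_affine[OF aff]) (use m s le in auto)
    moreover have "u (e + \<sigma> * (m ^ n * s)) = v (e + \<sigma> * (m ^ n * s))"
      using n m s by (intro germ) auto
    ultimately have "(y ^^ n) (u (e + \<sigma> * s)) = (y ^^ n) (v (e + \<sigma> * s))"
      using pow[of n "e + \<sigma> * s"] by simp
    then show ?thesis using inj_fn[OF y] by (auto dest: injD)
  next
    case False
    then have m1: "m > 1" using m by simp
    \<comment> \<open>Expansion: start from \<open>s / m ^ n\<close>, already in the region of
      agreement; its \<open>n\<close>-th iterate is the given point, and the iterates before it stay
      where \<open>y\<close> is affine.\<close>
    obtain n where "s / \<eta> < m ^ n" using real_arch_pow[OF m1] by blast
    then have n: "s / m ^ n < \<eta>" using m germ(1) by (simp add: field_simps)
    have le: "m ^ i * (s / m ^ n) \<le> \<delta>" if "i \<le> n" for i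
    proof -
      have "m ^ i * s \<le> m ^ n * s"
        using m1 that s by (intro mult_right_mono power_increasing) auto
      then have "m ^ i * (s / m ^ n) \<le> s" using m by (simp add: field_simps)
      also have "s \<le> \<delta>" using s by simp
      finally show ?thesis .
    qed
    have "(y ^^ n) (e + \<sigma> * (s / m ^ n)) = e + \<sigma> * (m ^ n * (s / m ^ n))"
      by (rule funpow_affine[OF aff]) (use m s le in auto)
    then have "(y ^^ n) (e + \<sigma> * (s / m ^ n)) = e + \<sigma> * s" using m by simp
    moreover have "u (e + \<sigma> * (s / m ^ n)) = v (e + \<sigma> * (s / m ^ n))"
      using n m s by (intro germ) auto
    ultimately show ?thesis using pow[of n "e + \<sigma> * (s / m ^ n)"] by simp
  qed
qed

text \<open>The sign \<open>\<sigma>\<close> selects the right (\<open>1\<close>) or left (\<open>-1\<close>) neighbourhood of \<open>e\<close>.\<close>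
definition affine_germ :: "real \<Rightarrow> (real \<Rightarrow> real) \<Rightarrow> real \<Rightarrow> bool" where
  "affine_germ \<sigma> f e \<longleftrightarrow> (\<exists>m>0. \<exists>\<delta>>0. \<forall>s\<in>{0..\<delta>}. f (e + \<sigma> * s) = e + \<sigma> * (m * s))"

text \<open>Near \<open>e\<close> both maps multiply the distance to \<open>e\<close> by a slope,
  and multiplications commute.\<close>

lemma affine_germs_commute:
  assumes "affine_germ \<sigma> f e" "affine_germ \<sigma> k e"
  shows "\<exists>\<eta>>0. \<forall>s\<in>{0<..<\<eta>}. f (k (e + \<sigma> * s)) = k (f (e + \<sigma> * s))"
proof -
  obtain m \<delta> where f: "m > 0" "\<delta> > 0" "\<And>s. s \<in> {0..\<delta>} \<Longrightarrow> f (e + \<sigma> * s) = e + \<sigma> * (m * s)"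
    using assms(1) by (auto simp: affine_germ_def)
  obtain m' \<delta>' where k: "m' > 0" "\<delta>' > 0" "\<And>s. s \<in> {0..\<delta>'} \<Longrightarrow> k (e + \<sigma> * s) = e + \<sigma> * (m' * s)"
    using assms(2) by (auto simp: affine_germ_def)
  \<comment> \<open>Both \<open>s\<close> and its image under either map must lie where the other
    map is affine.\<close>
  define \<eta> where "\<eta> = Min {\<delta>, \<delta>', \<delta> / m', \<delta>' / m}"
  have "\<eta> > 0" using f k by (simp add: \<eta>_def)
  moreover have "f (k (e + \<sigma> * s)) = k (f (e + \<sigma> * s))" if "s \<in> {0<..<\<eta>}" for s
  proof -
    have "s < \<delta>" "s < \<delta>'" "m' * s < \<delta>" "m * s < \<delta>'"
      using that f k by (auto simp: \<eta>_def field_simps)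
    then have "f (k (e + \<sigma> * s)) = e + \<sigma> * (m * (m' * s))" "k (f (e + \<sigma> * s)) = e + \<sigma> * (m' * (m * s))"
      using that f(1,2) k(1,2) f(3)[of s] f(3)[of "m' * s"] k(3)[of s] k(3)[of "m * s"] by auto
    then show ?thesis by simp
  qed
  ultimately show ?thesis by blast
qed

text \<open>The point is that \<open>\<delta>\<close> does not depend on \<open>f\<close> and \<open>k\<close>.\<close>
lemma centraliser_commutes_near:
  assumes "affine_germ \<sigma> y e" and moves: "\<And>\<epsilon>. \<epsilon> > 0 \<Longrightarrow> \<exists>s\<in>{0<..<\<epsilon>}. y (e + \<sigma> * s) \<noteq> e + \<sigma> * s"
    and "inj y"
  shows "\<exists>\<delta>>0. \<forall>f k. affine_germ \<sigma> f e \<longrightarrow> affine_germ \<sigma> k e \<longrightarrow>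
    (\<forall>t. f (y t) = y (f t)) \<longrightarrow> (\<forall>t. k (y t) = y (k t)) \<longrightarrow>
    (\<forall>s\<in>{0<..\<delta>}. f (k (e + \<sigma> * s)) = k (f (e + \<sigma> * s)))"
proof -
  obtain m \<delta> where y: "m > 0" "\<delta> > 0" "\<And>s. s \<in> {0..\<delta>} \<Longrightarrow> y (e + \<sigma> * s) = e + \<sigma> * (m * s)"
    using assms(1) by (auto simp: affine_germ_def)
  \<comment> \<open>Slope 1 would make \<open>y\<close> the identity near \<open>e\<close> on this
    side.\<close>
  have "m \<noteq> 1"
  proof
    assume "m = 1"
    obtain s where "s \<in> {0<..<\<delta>}" "y (e + \<sigma> * s) \<noteq> e + \<sigma> * s" using moves[OF y(2)] by blast
    then show False using y(3)[of s] \<open>m = 1\<close> by simp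
  qed
  have "f (k (e + \<sigma> * s)) = k (f (e + \<sigma> * s))"
    if fk: "affine_germ \<sigma> f e" "affine_germ \<sigma> k e" "\<And>t. f (y t) = y (f t)" "\<And>t. k (y t) = y (k t)"
      and s: "s \<in> {0<..\<delta>}" for f k s
  proof -
    obtain \<eta> where \<eta>: "\<eta> > 0" "\<And>s. s \<in> {0<..<\<eta>} \<Longrightarrow> f (k (e + \<sigma> * s)) = k (f (e + \<sigma> * s))"
      using affine_germs_commute[OF fk(1,2)] by blast
    \<comment> \<open>Both \<open>f \<circ> k\<close> and \<open>k \<circ> f\<close> commute with
      \<open>y\<close>, so their agreement on the small \<open>\<eta>\<close> spreads to
      \<open>\<delta>\<close>, which comes from \<open>y\<close> alone.\<close>
    show ?thesis
      by (rule commuting_eq_of_germ_eq[where u="\<lambda>t. f (k t)" and v="\<lambda>t. k (f t)" and y=y,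
            OF \<open>inj y\<close> y(3) y(1) \<open>m \<noteq> 1\<close> _ _ \<eta> s]) (simp_all only: fk)
  qed
  then show ?thesis using y(2) by (intro exI[of _ \<delta>] conjI allI impI ballI) simp_all
qed

section \<open>Increasing Thompson pairs on an invariant interval\<close>

lemma surj_image_eqI:
  assumes "surj f" "\<And>t. f t \<in> B \<longleftrightarrow> t \<in> A"
  shows "f ` A = B"
  using assms by (auto simp: image_iff) (metis surjD)

lemma strict_mono_inv_fun:
  fixes f :: "real \<Rightarrow> real"
  assumes "strict_mono f" "surj f"
  shows "strict_mono (inv f)"
proof (rule strict_monoI)
  fix x z :: real assume "x < z"
  then have "f (inv f x) < f (inv f z)" by (simp add: surj_f_inv_f[OF assms(2)])
  then show "inv f x < inv f z" by (simp only: strict_mono_less[OF assms(1)])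
qed

lemma strict_mono_mem_interval_iff:
  fixes f :: "real \<Rightarrow> real"
  assumes "strict_mono f" "f l = l" "f r = r"
  shows "f t \<in> {l<..<r} \<longleftrightarrow> t \<in> {l<..<r}"
  using strict_mono_less[OF assms(1), of l t] strict_mono_less[OF assms(1), of t r] assms(2,3)
  by simp

text \<open>The conjugating map \<open>f\<close> sends a right neighbourhood of \<open>l\<close>
  onto another one. This passes from \<open>y\<close> to its conjugate \<open>h 1\<close>.\<close>

lemma fixes_near_left_conj:
  assumes f: "strict_mono f" "surj f" "f l = l" and conj: "\<And>t. v (f t) = f (u t)"
    and u: "fixes_near_left u l"
  shows "fixes_near_left v l"
proof -
  obtain \<delta> where \<delta>: "\<delta> > 0" "\<And>x. x \<in> {l<..<l + \<delta>} \<Longrightarrow> u x = x"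
    using u by (auto simp: fixes_near_left_def)
  have "v x = x" if "x \<in> {l<..<f (l + \<delta>)}" for x
  proof -
    obtain w where w: "x = f w" using f(2) by blast
    have "w \<in> {l<..<l + \<delta>}"
      using that w strict_mono_less[OF f(1), of l w] strict_mono_less[OF f(1), of w "l + \<delta>"] f(3)
      by simp
    then show ?thesis using w conj \<delta> by simp
  qed
  moreover have "f (l + \<delta>) > l"
    using strict_monoD[OF f(1), of l "l + \<delta>"] \<delta>(1) f(3) by simp
  ultimately show ?thesis
    unfolding fixes_near_left_def by (intro exI[of _ "f (l + \<delta>) - l"]) simp
qed

locale thompson_interval = thompson_pair a b for a b :: "real \<Rightarrow> real" +
  fixes l r :: real
  assumes mono_a: "strict_mono a" and mono_b: "strict_mono b"
    and fixed_ends [simp]: "a l = l" "a r = r" "b l = l" "b r = r"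
begin

lemma mono_inv_a: "strict_mono (inv a)"
  using mono_a bij_a by (intro strict_mono_inv_fun) (auto simp: bij_is_surj)

lemma mono_y: "strict_mono y"
  unfolding y_def using mono_a strict_mono_inv_fun[OF mono_b bij_is_surj[OF bij_b]]
  by (simp add: strict_mono_def)

lemma fixed_ends_inv [simp]: "inv a l = l" "inv a r = r" "y l = l" "y r = r"
  using inverses(2)[of l] inverses(2)[of r] inverses(4)[of l] inverses(4)[of r]
  by (simp_all add: y_def)

lemma common_fixed_point_if_moves:
  assumes germ_g: "\<And>n. affine_germ 1 (g (Suc n)) l" "\<And>n. affine_germ (- 1) (g (Suc n)) r"
    and germ_y: "affine_germ 1 y l" "affine_germ (- 1) y r"
    and moves: "moves_near_left y l" "moves_near_right y r"
    and t: "t \<in> {l<..<r}" "g 1 (g 2 t) \<noteq> g 2 (g 1 t)"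
  shows "\<exists>s\<in>{l<..<r}. a s = s \<and> b s = s"
proof -
  define D where
    "D n = {t \<in> {l<..<r}. g (Suc n) (g (Suc (Suc n)) t) \<noteq> g (Suc (Suc n)) (g (Suc n) t)}" for n
  have inj_y: "inj y" using bij_y by (rule bij_is_inj)
  have "\<exists>s\<in>{0<..<\<epsilon>}. y (l + 1 * s) \<noteq> l + 1 * s" if "\<epsilon> > 0" for \<epsilon>
  proof -
    obtain x where "x \<in> {l<..<l + \<epsilon>}" "y x \<noteq> x"
      using moves(1) \<open>\<epsilon> > 0\<close> unfolding moves_near_left_def by blast
    then show ?thesis by (intro bexI[of _ "x - l"]) auto
  qed
  \<comment> \<open>One \<open>\<delta>\<close> serves all \<open>n\<close>, since every
    \<open>g (Suc n)\<close> centralises \<open>y\<close>; it keeps all \<open>D n\<close> away from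
    \<open>l\<close>.\<close>
  from centraliser_commutes_near[OF germ_y(1) this inj_y]
  obtain \<delta> where \<delta>: "\<delta> > 0" "\<And>n s. s \<in> {0<..\<delta>} \<Longrightarrow>
      g (Suc n) (g (Suc (Suc n)) (l + 1 * s)) = g (Suc (Suc n)) (g (Suc n) (l + 1 * s))"
    using germ_g(1) y_g by metis
  have "\<exists>s\<in>{0<..<\<epsilon>}. y (r + - 1 * s) \<noteq> r + - 1 * s" if "\<epsilon> > 0" for \<epsilon>
  proof -
    obtain x where "x \<in> {r - \<epsilon><..<r}" "y x \<noteq> x"
      using moves(2) \<open>\<epsilon> > 0\<close> unfolding moves_near_right_def by blast
    then show ?thesis by (intro bexI[of _ "r - x"]) auto
  qed
  from centraliser_commutes_near[OF germ_y(2) this inj_y]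
  obtain \<delta>' where \<delta>': "\<delta>' > 0" "\<And>n s. s \<in> {0<..\<delta>'} \<Longrightarrow>
      g (Suc n) (g (Suc (Suc n)) (r + - 1 * s)) = g (Suc (Suc n)) (g (Suc n) (r + - 1 * s))"
    using germ_g(2) y_g by metis
  have "\<exists>s\<in>{l + \<delta>..r - \<delta>'}. a s = s \<and> y s = s"
  proof (rule common_fixed_point[where D = D])
    show "D 0 \<noteq> {}" using t by (auto simp: D_def numeral_2_eq_2)
    show "D n \<subseteq> {l + \<delta>..r - \<delta>'}" for n
    proof
      fix x assume x: "x \<in> D n"
      then have "\<not> x < l + \<delta>" using \<delta>(2)[of "x - l" n] by (auto simp: D_def)
      moreover have "\<not> x > r - \<delta>'" using x \<delta>'(2)[of "r - x" n] by (auto simp: D_def)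
      ultimately show "x \<in> {l + \<delta>..r - \<delta>'}" by simp
    qed
    show "D (Suc n) = a ` D n" for n
    proof (rule surj_image_eqI[symmetric])
      show "a t \<in> D (Suc n) \<longleftrightarrow> t \<in> D n" for t
        unfolding D_def using strict_mono_mem_interval_iff[OF mono_a fixed_ends(1,2)]
        by (simp add: a_g[symmetric] strict_mono_eq[OF mono_a] del: greaterThanLessThan_iff)
    qed (rule bij_is_surj[OF bij_a])
    show "y ` D n = D n" for n
    proof (rule surj_image_eqI)
      show "y t \<in> D n \<longleftrightarrow> t \<in> D n" for t
        unfolding D_def using strict_mono_mem_interval_iff[OF mono_y fixed_ends_inv(3,4)]
        by (simp add: y_g[symmetric] strict_mono_eq[OF mono_y] del: greaterThanLessThan_iff)
    qed (rule bij_is_surj[OF bij_y])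
  qed (use mono_a mono_y bij_a bij_y in \<open>simp_all add: bij_is_surj\<close>)
  then obtain s where s: "s \<in> {l + \<delta>..r - \<delta>'}" "a s = s" "y s = s" by blast
  then have "b s = s" using b_y[of s] by simp
  then show ?thesis using s \<delta>(1) \<delta>'(1) by (intro bexI[of _ s]) auto
qed

lemma common_fixed_point_if_fixes:
  assumes y: "fixes_near_left y l" "fixes_near_right y r"
    and h1: "fixes_near_left (h 1) l" "fixes_near_right (h 1) r"
    and t: "t \<in> {l<..<r}" "y t \<noteq> t"
  shows "\<exists>s\<in>{l<..<r}. a s = s \<and> b s = s"
proof -
  \<comment> \<open>The index is \<open>Suc n\<close> because \<open>b_h\<close> holds for positive
    indices.\<close>
  define D where "D n = {t \<in> {l<..<r}. h (Suc n) t \<noteq> t}" for n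
  \<comment> \<open>Halving the smaller radius gives a point inside both neighbourhoods, so
    \<open>y\<close> fixes it.\<close>
  obtain l' where l': "l < l'" "y l' = l'" "\<And>x. x \<in> {l<..<l'} \<Longrightarrow> h 1 x = x"
  proof -
    obtain \<delta> \<delta>' where "\<delta> > 0" "\<And>x. x \<in> {l<..<l + \<delta>} \<Longrightarrow> y x = x"
      "\<delta>' > 0" "\<And>x. x \<in> {l<..<l + \<delta>'} \<Longrightarrow> h 1 x = x"
      using y(1) h1(1) unfolding fixes_near_left_def by blast
    then show thesis by (intro that[of "l + min \<delta> \<delta>' / 2"]) auto
  qed
  obtain r' where r': "r' < r" "y r' = r'" "\<And>x. x \<in> {r'<..<r} \<Longrightarrow> h 1 x = x"
  proof -
    obtain \<delta> \<delta>' where "\<delta> > 0" "\<And>x. x \<in> {r - \<delta><..<r} \<Longrightarrow> y x = x"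
      "\<delta>' > 0" "\<And>x. x \<in> {r - \<delta>'<..<r} \<Longrightarrow> h 1 x = x"
      using y(2) h1(2) unfolding fixes_near_right_def by blast
    then show thesis by (intro that[of "r - min \<delta> \<delta>' / 2"]) auto
  qed
  have step: "D (Suc n) = inv a ` D n" for n
  proof (rule surj_image_eqI[symmetric])
    show "inv a t \<in> D (Suc n) \<longleftrightarrow> t \<in> D n" for t
      unfolding D_def using strict_mono_mem_interval_iff[OF mono_inv_a fixed_ends_inv(1,2)]
      by (simp add: inv_a_h[symmetric] strict_mono_eq[OF mono_inv_a] del: greaterThanLessThan_iff)
  qed (use bij_a in \<open>simp add: bij_imp_bij_inv bij_is_surj\<close>)
  have b_D: "b ` D n = D n" for n
  proof (rule surj_image_eqI)
    show "b t \<in> D n \<longleftrightarrow> t \<in> D n" for t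
      unfolding D_def using strict_mono_mem_interval_iff[OF mono_b fixed_ends(3,4)]
      by (simp add: b_h[symmetric] strict_mono_eq[OF mono_b] del: greaterThanLessThan_iff)
  qed (rule bij_is_surj[OF bij_b])
  have "\<exists>s\<in>{l'..r'}. inv a s = s \<and> b s = s"
  proof (rule common_fixed_point[where D = D])
    have "h 1 (inv a t) \<noteq> inv a t"
      using inv_a_h[of 0 t] t(2) strict_mono_eq[OF mono_inv_a] by (simp add: h_def)
    moreover have "inv a t \<in> {l<..<r}"
      using strict_mono_mem_interval_iff[OF mono_inv_a fixed_ends_inv(1,2)] t(1) by blast
    ultimately show "D 0 \<noteq> {}" by (auto simp: D_def)
    show "D n \<subseteq> {l'..r'}" for n
    proof (induction n)
      case 0
      show ?case
      proof
        fix x assume "x \<in> D 0"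
        then have "x \<in> {l<..<r}" "h 1 x \<noteq> x" by (auto simp: D_def)
        then show "x \<in> {l'..r'}" using l'(3)[of x] r'(3)[of x] by force
      qed
    next
      case (Suc n)
      show ?case
      proof
        fix x assume "x \<in> D (Suc n)"
        \<comment> \<open>Since \<open>b\<close> preserves \<open>D n\<close> and
          \<open>inv a \<circ> b\<close> is the inverse of \<open>y\<close>, the map
          \<open>y\<close> sends \<open>D (Suc n)\<close> into \<open>D n\<close>. The bounds pass
          back to \<open>x\<close> because \<open>y\<close> is increasing and fixes
          \<open>l'\<close> and \<open>r'\<close>.\<close>
        then obtain w where w: "w \<in> D n" "x = inv a (b w)"
          using step b_D by (metis imageE)
        then have "y x = w" by (simp add: y_def)
        then have "y l' \<le> y x" "y x \<le> y r'" using Suc w(1) l'(2) r'(2) by auto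
        then show "x \<in> {l'..r'}" by (simp add: strict_mono_less_eq[OF mono_y])
      qed
    qed
  qed (use mono_inv_a mono_b bij_a bij_b step b_D
      in \<open>simp_all add: bij_is_surj bij_imp_bij_inv\<close>)
  then obtain s where s: "s \<in> {l'..r'}" "inv a s = s" "b s = s" by blast
  then have "a s = s" using inverses(1)[of s] by simp
  then show ?thesis using s l'(1) r'(1) by (intro bexI[of _ s]) auto
qed

text \<open>Where \<open>y\<close> is the identity, \<open>a\<close> and \<open>b\<close> agree, and
  then so does every \<open>g n\<close>. The contrapositive supplies a point moved by
  \<open>y\<close>.\<close>

lemma g_commute_if_y_trivial:
  assumes "\<And>t. t \<in> {l<..<r} \<Longrightarrow> y t = t" and t: "t \<in> {l<..<r}"
  shows "g 1 (g 2 t) = g 2 (g 1 t)"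
proof -
  have ab: "b t = a t" if "t \<in> {l<..<r}" for t
    using assms(1)[OF that] b_y[of t] by simp
  have inv: "inv a t \<in> {l<..<r}" "a t \<in> {l<..<r}" if "t \<in> {l<..<r}" for t
    using that strict_mono_mem_interval_iff[OF mono_inv_a fixed_ends_inv(1,2)]
      strict_mono_mem_interval_iff[OF mono_a fixed_ends(1,2)] by blast+
  have g: "g n t = a t" if "t \<in> {l<..<r}" for n t
    using that
  proof (induction n arbitrary: t)
    case 0
    then show ?case using ab by (simp add: g_def)
  next
    case (Suc n)
    then show ?case using inv(1) by (simp only: g_Suc inverses)
  qed
  show ?thesis using t inv(2) by (simp only: g)
qed

end

section \<open>Piecewise-linear homeomorphisms and orbitals\<close>

lemma PL0_eq_id_outside: "f \<in> PL0 \<Longrightarrow> x \<notin> {0..1} \<Longrightarrow> f x = x"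
  by (simp add: PL0_def)

lemma PL0_mem_unit: "f \<in> PL0 \<Longrightarrow> x \<in> {0..1} \<Longrightarrow> f x \<in> {0..1}"
  unfolding PL0_def by blast

lemma PL0_strict_mono:
  assumes "f \<in> PL0"
  shows "strict_mono f"
proof (rule strict_monoI)
  fix x z :: real assume "x < z"
  have "f x < f z" if "x \<in> {0..1}" "z \<in> {0..1}"
    using assms \<open>x < z\<close> that unfolding PL0_def strict_mono_on_def by blast
  then show "f x < f z"
    using \<open>x < z\<close> PL0_mem_unit[OF assms, of x] PL0_mem_unit[OF assms, of z]
      PL0_eq_id_outside[OF assms, of x] PL0_eq_id_outside[OF assms, of z]
    by (cases "x \<in> {0..1}"; cases "z \<in> {0..1}") auto
qed

lemma PL0_surj:
  assumes "f \<in> PL0"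
  shows "surj f"
proof -
  have "z \<in> range f" for z
  proof (cases "z \<in> {0..1}")
    case True
    then have "z \<in> f ` {0..1}" using assms by (simp add: PL0_def)
    then show ?thesis by blast
  qed (metis PL0_eq_id_outside[OF assms] rangeI)
  then show ?thesis by blast
qed

lemma PL0_bij: "f \<in> PL0 \<Longrightarrow> bij f"
  by (simp add: bij_def PL0_surj PL0_strict_mono strict_mono_imp_inj_on)

lemma PL0_fixes_ends:
  assumes "f \<in> PL0"
  shows "f 0 = 0" "f 1 = 1"
proof -
  have "f ` {0..1} = {0..1}" using assms by (simp add: PL0_def)
  then have "0 \<in> f ` {0..1}" "1 \<in> f ` {0..1}" by simp_all
  then obtain x z where "x \<in> {0..1}" "f x = 0" "z \<in> {0..1}" "f z = 1" by (metis imageE)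
  then show "f 0 = 0" "f 1 = 1"
    using strict_mono_less_eq[OF PL0_strict_mono[OF assms], of 0 x]
      strict_mono_less_eq[OF PL0_strict_mono[OF assms], of z 1]
      PL0_mem_unit[OF assms, of 0] PL0_mem_unit[OF assms, of 1] by auto
qed

text \<open>The piece is where the list first rises above \<open>e\<close>; a breakpoint equal to
  \<open>e\<close> opens it. In the left-hand version such a breakpoint closes the piece.\<close>

lemma subdivision_piece_right:
  fixes e :: real
  assumes "ts \<noteq> []" "hd ts \<le> e" "e < last ts"
  shows "\<exists>i. Suc i < length ts \<and> ts ! i \<le> e \<and> e < ts ! Suc i"
  using assms
proof (induction ts)
  case (Cons x ts)
  show ?case
  proof (cases "ts \<noteq> [] \<and> hd ts \<le> e")
    case True
    then obtain i where "Suc i < length ts" "ts ! i \<le> e" "e < ts ! Suc i"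
      using Cons by auto
    then show ?thesis by (intro exI[of _ "Suc i"]) simp
  next
    case False
    then show ?thesis using Cons.prems by (cases ts) (auto intro!: exI[of _ 0])
  qed
qed simp

lemma subdivision_piece_left:
  fixes e :: real
  assumes "ts \<noteq> []" "hd ts < e" "e \<le> last ts"
  shows "\<exists>i. Suc i < length ts \<and> ts ! i < e \<and> e \<le> ts ! Suc i"
  using assms
proof (induction ts)
  case (Cons x ts)
  show ?case
  proof (cases "ts \<noteq> [] \<and> hd ts < e")
    case True
    then obtain i where "Suc i < length ts" "ts ! i < e" "e \<le> ts ! Suc i"
      using Cons by auto
    then show ?thesis by (intro exI[of _ "Suc i"]) simp
  next
    case False
    then show ?thesis using Cons.prems by (cases ts) (auto intro!: exI[of _ 0])
  qed
qed simp

lemma PL0_subdivision: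
  assumes "f \<in> PL0"
  obtains ts where "ts \<noteq> []" "hd ts = 0" "last ts = 1"
    "\<And>i. Suc i < length ts \<Longrightarrow> \<exists>m k. \<forall>x \<in> {ts ! i..ts ! Suc i}. f x = m * x + k"
  using assms unfolding PL0_def by blast

text \<open>On the piece to the right of \<open>e\<close>, \<open>f e = e\<close> determines the
  constant term and strict monotonicity makes the slope positive.\<close>

lemma PL0_affine_germ_right:
  assumes f: "f \<in> PL0" and e: "f e = e" "0 \<le> e" "e < 1"
  shows "affine_germ 1 f e"
proof -
  obtain ts where ts: "ts \<noteq> []" "hd ts = 0" "last ts = 1"
    "\<And>i. Suc i < length ts \<Longrightarrow> \<exists>m k. \<forall>x \<in> {ts ! i..ts ! Suc i}. f x = m * x + k"
    using PL0_subdivision[OF f] by blast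
  then obtain i where i: "Suc i < length ts" "ts ! i \<le> e" "e < ts ! Suc i"
    using subdivision_piece_right[of ts e] e by auto
  define q where "q = ts ! Suc i"
  obtain m k where mk: "\<And>x. x \<in> {e..q} \<Longrightarrow> f x = m * x + k"
    using ts(4)[OF i(1)] i q_def by fastforce
  have eq: "e < q" using i q_def by simp
  have k: "k = e - m * e" using mk[of e] e eq by simp
  have "f e < f q" using strict_monoD[OF PL0_strict_mono[OF f] eq] .
  then have "0 < m * (q - e)" using mk[of q] e eq k by (simp add: algebra_simps)
  then have "m > 0" using eq by (simp add: zero_less_mult_iff)
  moreover have "f (e + 1 * s) = e + 1 * (m * s)" if "s \<in> {0..q - e}" for s
    using mk[of "e + s"] that k by (simp add: algebra_simps)
  ultimately show ?thesis
    unfolding affine_germ_def using eq by (intro exI[of _ m] conjI exI[of _ "q - e"]) auto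
qed

lemma PL0_affine_germ_left:
  assumes f: "f \<in> PL0" and e: "f e = e" "0 < e" "e \<le> 1"
  shows "affine_germ (- 1) f e"
proof -
  obtain ts where ts: "ts \<noteq> []" "hd ts = 0" "last ts = 1"
    "\<And>i. Suc i < length ts \<Longrightarrow> \<exists>m k. \<forall>x \<in> {ts ! i..ts ! Suc i}. f x = m * x + k"
    using PL0_subdivision[OF f] by blast
  then obtain i where i: "Suc i < length ts" "ts ! i < e" "e \<le> ts ! Suc i"
    using subdivision_piece_left[of ts e] e by auto
  define q where "q = ts ! i"
  obtain m k where mk: "\<And>x. x \<in> {q..e} \<Longrightarrow> f x = m * x + k"
    using ts(4)[OF i(1)] i q_def by fastforce
  have eq: "q < e" using i q_def by simp
  have k: "k = e - m * e" using mk[of e] e eq by simp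
  have "f q < f e" using strict_monoD[OF PL0_strict_mono[OF f] eq] .
  then have "0 < m * (e - q)" using mk[of q] e eq k by (simp add: algebra_simps)
  then have "m > 0" using eq by (simp add: zero_less_mult_iff)
  moreover have "f (e + - 1 * s) = e + - 1 * (m * s)" if "s \<in> {0..e - q}" for s
    using mk[of "e - s"] that k by (simp add: algebra_simps)
  ultimately show ?thesis
    unfolding affine_germ_def using eq by (intro exI[of _ m] conjI exI[of _ "e - q"]) auto
qed

text \<open>The common fixed points form a closed set \<open>Z\<close> containing 0 and 1; the ends
  are the points of \<open>Z\<close> nearest to \<open>t\<close> on either side.\<close>

lemma Supp_in_orbital:
  assumes H: "H \<subseteq> PL0" and t: "t \<in> Supp H"
  obtains l r where "orbital H l r" "t \<in> {l<..<r}"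
proof -
  define Z where "Z = (\<Inter>h\<in>H. {x. h x = x})"
  have "closed {x. h x = x}" if "h \<in> H" for h
  proof -
    have "h \<in> PL0" using H that by blast
    then show ?thesis
      using isCont_strict_mono_surj[OF PL0_strict_mono PL0_surj]
      by (intro closed_Collect_eq continuous_at_imp_continuous_on) auto
  qed
  then have closed: "closed Z" unfolding Z_def by blast
  have ends: "0 \<in> Z" "1 \<in> Z" using H PL0_fixes_ends unfolding Z_def by blast+
  have Supp_iff: "x \<in> Supp H \<longleftrightarrow> x \<in> {0..1} \<and> x \<notin> Z" for x
    by (auto simp: Supp_def Z_def)
  have t01: "t \<in> {0..1}" "t \<notin> Z" using t Supp_iff by auto
  have compact: "compact ({0..t} \<inter> Z)" "compact ({t..1} \<inter> Z)"
    using closed by (simp_all add: compact_Int_closed)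
  obtain l where l: "l \<in> {0..t} \<inter> Z" "\<And>x. x \<in> {0..t} \<inter> Z \<Longrightarrow> x \<le> l"
    using compact_attains_sup[OF compact(1)] ends t01 by fastforce
  obtain r where r: "r \<in> {t..1} \<inter> Z" "\<And>x. x \<in> {t..1} \<inter> Z \<Longrightarrow> r \<le> x"
    using compact_attains_inf[OF compact(2)] ends t01 by fastforce
  have "x \<notin> Z" if "x \<in> {l<..<r}" for x
    using l(1) l(2)[of x] r(1) r(2)[of x] that by (cases "x \<le> t") auto
  moreover have "l \<noteq> t" "r \<noteq> t" using l r t01 by auto
  ultimately have "orbital H l r" "t \<in> {l<..<r}"
    using l r by (auto simp: orbital_def Supp_iff)
  then show thesis by (rule that)
qed

section \<open>Realising words by elements of \<open>H\<close>\<close>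

text \<open>\<open>e\<close> sends a word to the preimage of its class under the isomorphism. The
  reversed product of \<open>PL0_group\<close> matches \<open>word_action\<close>.\<close>

lemma thompson_F_representation:
  assumes H: "subgroup H PL0_group" and iso: "PL0_group\<lparr>carrier := H\<rparr> \<cong> thompson_F"
  obtains e where "word_action e" "range e = H" "\<And>u v. e u = e v \<longleftrightarrow> (u, v) \<in> F_equiv"
proof -
  obtain \<phi> where \<phi>: "\<phi> \<in> hom (PL0_group\<lparr>carrier := H\<rparr>) thompson_F"
    and bij: "bij_betw \<phi> H (UNIV // F_equiv)"
    using iso by (auto simp: is_iso_def iso_def thompson_F_def)
  have HP: "H \<subseteq> PL0" using subgroup.subset[OF H] by (simp add: PL0_group_def)
  have comp: "g \<circ> f \<in> H" if "f \<in> H" "g \<in> H" for f g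
    using subgroup.m_closed[OF H that] by (simp add: PL0_group_def)
  have \<phi>_comp: "\<phi> (g \<circ> f) = \<phi> f \<otimes>\<^bsub>thompson_F\<^esub> \<phi> g" if "f \<in> H" "g \<in> H" for f g
    using hom_mult[OF \<phi>] that by (simp add: PL0_group_def)
  define e where "e w = inv_into H \<phi> (F_equiv `` {w})" for w
  have cls: "F_equiv `` {w} \<in> \<phi> ` H" for w
    using bij by (auto simp: bij_betw_def quotientI)
  have e_H: "e w \<in> H" and \<phi>_e: "\<phi> (e w) = F_equiv `` {w}" for w
    using cls[of w] by (simp_all add: e_def inv_into_into f_inv_into_f)
  have inj: "inj_on \<phi> H" using bij by (simp add: bij_betw_def)
  have append: "e (u @ v) = e v \<circ> e u" for u v
    by (rule inj_onD[OF inj]) (simp_all add: \<phi>_comp \<phi>_e thompson_F_mult e_H comp)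
  have eq_iff: "e u = e v \<longleftrightarrow> (u, v) \<in> F_equiv" for u v
  proof -
    have "e u = e v \<longleftrightarrow> F_equiv `` {u} = F_equiv `` {v}"
      using \<phi>_e e_def by metis
    then show ?thesis using eq_equiv_class_iff[OF equiv_F_equiv] by simp
  qed
  have Nil: "e [] = id"
  proof
    fix t
    \<comment> \<open>An injective idempotent map is the identity.\<close>
    have "e [] (e [] t) = e [] t" using append[of "[]" "[]"] by (auto simp: fun_eq_iff)
    then show "e [] t = id t"
      using PL0_bij[of "e []"] e_H HP by (auto simp: bij_def dest: injD)
  qed
  have "word_action e"
  proof
    show "e [l, letter_inv l] = id" for l
      using Nil eq_iff[of "[l, letter_inv l]" "[]"] F_equiv.cancel by simp
  qed (rule Nil append)+
  moreover have "range e = H"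
  proof
    show "H \<subseteq> range e"
    proof
      fix f assume f: "f \<in> H"
      then have "\<phi> f \<in> UNIV // F_equiv" using bij by (auto simp: bij_betw_def)
      then obtain w where "\<phi> f = F_equiv `` {w}" by (auto elim: quotientE)
      then have "e w = f" using f inj by (simp add: e_def[of w] flip: \<open>\<phi> f = _\<close>)
      then show "f \<in> range e" by blast
    qed
  qed (use e_H in blast)
  ultimately show thesis using eq_iff that by blast
qed

section \<open>The contradiction on a single orbital\<close>

theorem theorem3p2:
  fixes H :: "(real \<Rightarrow> real) set"
  assumes "subgroup H PL0_group"
    and "PL0_group\<lparr>carrier := H\<rparr> \<cong> thompson_F"
  shows "\<exists>a c h. orbital H a c \<and> h \<in> H \<and>
           ((moves_near_left h a \<and> fixes_near_right h c) \<or>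
            (moves_near_right h c \<and> fixes_near_left h a))"
proof (rule ccontr)
  assume contra: "\<not> ?thesis"
  have HP: "H \<subseteq> PL0" using subgroup.subset[OF assms(1)] by (simp add: PL0_group_def)
  obtain e where "word_action e" and range_e: "range e = H"
    and e_eq: "\<And>u v. e u = e v \<longleftrightarrow> (u, v) \<in> F_equiv"
    using thompson_F_representation[OF assms] by blast
  interpret word_action e by fact
  have e_PL0: "e w \<in> PL0" for w using HP range_e by blast
  define a b where "a = e [fx0]" and "b = e [fx1]"
  have inv_ab: "inv a = e [fX0]" "inv b = e [fX1]"
    unfolding a_def b_def e_word_inv[symmetric] by (simp_all add: word_defs)
  have aa: "e [fx0, fx0] = a \<circ> a" and y: "e [fx0, fX1] = inv b \<circ> a"
    unfolding inv_ab a_def using e_append[of "[fx0]" "[fx0]"] e_append[of "[fx0]" "[fX1]"] by simp_all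
  have rel: "e r = id" if "r \<in> F_relators" for r
    using e_eq[of r "[]"] F_equiv.relator[OF that] e_Nil by simp
  have "thompson_pair a b"
  proof
    show "(inv b \<circ> a) \<circ> (a \<circ> b \<circ> inv a) = (a \<circ> b \<circ> inv a) \<circ> (inv b \<circ> a)"
      using rel[of "word_comm [fx0, fX1] (word_conj [fx1] [fx0])"]
      unfolding e_word_comm_eq_id_iff e_word_conj y a_def[symmetric] b_def[symmetric]
      by (simp add: F_relators_def)
    show "(inv b \<circ> a) \<circ> (a \<circ> a \<circ> b \<circ> inv (a \<circ> a)) = (a \<circ> a \<circ> b \<circ> inv (a \<circ> a)) \<circ> (inv b \<circ> a)"
      using rel[of "word_comm [fx0, fX1] (word_conj [fx1] [fx0, fx0])"]
      unfolding e_word_comm_eq_id_iff e_word_conj y aa b_def[symmetric]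
      by (simp add: F_relators_def)
  qed (simp_all add: a_def b_def bij_e)
  then interpret thompson_pair a b .

  have comp_H: "f \<circ> k \<in> H" if "f \<in> H" "k \<in> H" for f k
  proof -
    obtain u v where "k = e u" "f = e v" using \<open>f \<in> H\<close> \<open>k \<in> H\<close> unfolding range_e[symmetric] by (elim rangeE)
    then show ?thesis using e_append[of u v] range_e by (metis rangeI)
  qed
  have gen_H: "a \<in> H" "b \<in> H" "inv a \<in> H" "inv b \<in> H"
    unfolding inv_ab using range_e by (auto simp: a_def b_def)
  have y_H: "y \<in> H" unfolding y_def by (intro comp_H gen_H)
  have g_H: "g n \<in> H" for n
  proof (induction n)
    case (Suc n)
    have "g (Suc n) = a \<circ> (g n \<circ> inv a)" by (rule ext) (simp add: g_Suc)
    then show ?case using Suc comp_H gen_H by metis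
  qed (use gen_H in \<open>simp add: g_def\<close>)
  have h_1: "h 1 = inv a \<circ> (y \<circ> a)" by (simp add: h_def comp_assoc)
  have h_H: "h 1 \<in> H" unfolding h_1 by (intro comp_H gen_H y_H)

  obtain t0 where "g 1 (b t0) \<noteq> b (g 1 t0)"
  proof -
    have "e (word_conj [fx1] [fx0]) = g 1"
      unfolding g_1 e_word_conj a_def[symmetric] b_def[symmetric] ..
    then have "g 1 \<circ> b \<noteq> b \<circ> g 1"
      using F_not_abelian unfolding e_eq[symmetric] e_append b_def[symmetric] by metis
    then show thesis using that by (auto simp: fun_eq_iff)
  qed
  \<comment> \<open>Applying \<open>a\<close> moves the noncommuting pair \<open>b = g 0\<close>,
    \<open>g 1\<close> to \<open>g 1\<close>, \<open>g 2\<close>, whose positive indices make both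
    commute with \<open>y\<close>.\<close>
  define t where "t = a t0"
  have "g 1 (g 2 t) \<noteq> g 2 (g 1 t)"
  proof
    assume "g 1 (g 2 t) = g 2 (g 1 t)"
    then have "a (b (g 1 t0)) = a (g 1 (b t0))"
      by (simp add: t_def a_b a_g numeral_2_eq_2)
    then show False using \<open>g 1 (b t0) \<noteq> b (g 1 t0)\<close> inverses(2) by metis
  qed
  then have "g 1 t \<noteq> t \<or> g 2 t \<noteq> t" by metis
  then have "t \<in> Supp H"
    unfolding Supp_def using g_H[of 1] g_H[of 2] HP PL0_eq_id_outside by blast
  then obtain l r where lr: "orbital H l r" and t: "t \<in> {l<..<r}"
    using Supp_in_orbital[OF HP] by blast
  have "{l<..<r} \<subseteq> {0..1}" "l < r" using lr by (auto simp: orbital_def Supp_def)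
  then have bounds: "0 \<le> l" "l < r" "r \<le> 1"
    using greaterThanLessThan_subseteq_atLeastAtMost_iff[of l r 0 1] by auto
  have fix_lr: "f l = l" "f r = r" if "f \<in> H" for f
    using lr that bounds unfolding orbital_def Supp_def by auto
  interpret thompson_interval a b l r
    using gen_H fix_lr bounds HP PL0_strict_mono by unfold_locales auto
  \<comment> \<open>A point fixed by \<open>a\<close> and \<open>b\<close> is fixed by all words,
    hence lies outside \<open>Supp H\<close>.\<close>
  have no_fixed: "\<not> (\<exists>s\<in>{l<..<r}. a s = s \<and> b s = s)"
  proof
    assume "\<exists>s\<in>{l<..<r}. a s = s \<and> b s = s"
    then obtain s where s: "s \<in> {l<..<r}" "a s = s" "b s = s" by blast
    have inv_s: "inv a s = s" "inv b s = s"
      using inverses(2)[of s] inverses(4)[of s] s by simp_all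
    have letter: "e [x] s = s" for x
    proof -
      have "x \<in> {fx0, fX0, fx1, fX1}" by (cases x) (auto simp: word_defs)
      then show ?thesis
        using s inv_s inv_ab a_def b_def by auto
    qed
    have "e w s = s" for w
    proof (induction w)
      case (Cons x w)
      then show ?case using letter[of x] by (simp add: e_Cons[of x w])
    qed (simp add: e_Nil)
    then have "s \<notin> Supp H" unfolding Supp_def range_e[symmetric] by auto
    then show False using s(1) lr by (auto simp: orbital_def)
  qed
  \<comment> \<open>Moving near an end is the negation of fixing near it, so the assumed failure of
    the theorem on this orbital forces the equivalence.\<close>
  have ends: "fixes_near_left f l \<longleftrightarrow> fixes_near_right f r" if "f \<in> H" for f
  proof -
    have "moves_near_left f l \<longleftrightarrow> \<not> fixes_near_left f l"
      "moves_near_right f r \<longleftrightarrow> \<not> fixes_near_right f r"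
      unfolding moves_near_left_def moves_near_right_def fixes_near_left_def fixes_near_right_def
      by blast+
    then show ?thesis using contra lr that by blast
  qed
  show False
  proof (cases "fixes_near_left y l")
    case True
    \<comment> \<open>\<open>h 1\<close> is the conjugate of \<open>y\<close> by
      \<open>inv a\<close>; its triviality near \<open>r\<close> then comes from
      \<open>ends\<close>.\<close>
    have "fixes_near_left (h 1) l"
      using mono_inv_a bij_a True inv_a_h[of 0]
      by (intro fixes_near_left_conj[of "inv a" l "h 1" y])
        (simp_all add: bij_is_surj bij_imp_bij_inv h_def)
    moreover obtain t' where "t' \<in> {l<..<r}" "y t' \<noteq> t'"
      using g_commute_if_y_trivial[OF _ t] \<open>g 1 (g 2 t) \<noteq> g 2 (g 1 t)\<close> by blast
    ultimately show False
      using common_fixed_point_if_fixes True ends y_H h_H no_fixed by blast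
  next
    case False
    then have "moves_near_left y l" "moves_near_right y r"
      using ends[OF y_H]
      unfolding moves_near_left_def moves_near_right_def fixes_near_left_def fixes_near_right_def
      by blast+
    moreover have "affine_germ 1 f l" "affine_germ (- 1) f r" if "f \<in> H" for f
      using that HP fix_lr bounds PL0_affine_germ_right PL0_affine_germ_left by auto
    ultimately show False
      using common_fixed_point_if_moves g_H y_H t \<open>g 1 (g 2 t) \<noteq> g 2 (g 1 t)\<close> no_fixed by blast
  qed
qed

end
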